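(* If $f=h+\overline{g}\in\mathcal{F}_0$, then $\|S_f\|\le 3$. The estimate is best possible, i.e. the constant $3$ cannot be replaced by any smaller constant valid for all $f\in\mathcal{F}_0$.
   Context: $\mathbb{D}=\{z\in\mathbb{C}:|z|<1\}$. $\mathcal{H}$ is the class of all complex-valued harmonic mappings $f=h+\overline{g}$ in $\mathbb{D}$ with $h,g$ analytic in $\mathbb{D}$ and $h(0)=h'(0)-1=g(0)=0$, so that $h(z)=z+\sum_{n=2}^\infty a_nz^n$ and $g(z)=\sum_{n=1}^\infty b_nz^n$. $Aut(\mathbb{D})=\{e^{i\theta}\frac{z-a}{1-\overline{a}z}: a\in\mathbb{D},\ \theta\in\mathbb{R}\}$. $\mathcal{F}_0$ is the class of all $f=h+\overline{g}\in\mathcal{H}$ such that $h'\ne 0$ in $\mathbb{D}$, $$\mathrm{Re}\left(1+\frac{zh''(z)}{h'(z)}\right)>0\quad\text{for all } z\in\mathbb{D},$$ and the dilatation $\omega_f=g'/h'$ belongs to $Aut(\mathbb{D})$. The Jacobian of $f$ is $J_f=|h'|^2-|g'|^2$. For a locally univalent sense-preserving harmonic mapping $f=h+\overline{g}$ with dilatation $\omega=g'/h'$, the Schwarzian derivative is $$S_f=(\log J_f)_{zz}-\frac12\big((\log J_f)_z\big)^2=S_h+\frac{\overline{\omega}}{1-|\omega|^2}\left(\frac{h''}{h'}\omega'-\omega''\right)-\frac32\left(\frac{\omega'\overline{\omega}}{1-|\omega|^2}\right)^2,$$ where $S_h=\left(\frac{h''}{h'}\right)'-\frac12\left(\frac{h''}{h'}\right)^2$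 is the classical Schwarzian derivative of the analytic function $h$. The Schwarzian norm is $\|S_f\|=\sup_{z\in\mathbb{D}}(1-|z|^2)^2|S_f(z)|$. *)

theory Defs
  imports "HOL-Complex_Analysis.Complex_Analysis"
begin

abbreviation unit_disc :: "complex set" where
  "unit_disc \<equiv> ball 0 1"

text \<open>Mappings of the disc are total functions on the complex plane; only their values on
  the open unit disc matter in everything below.\<close>

definition canonical_rep ::
    "(complex \<Rightarrow> complex) \<Rightarrow> (complex \<Rightarrow> complex) \<Rightarrow> (complex \<Rightarrow> complex) \<Rightarrow> bool" where
  "canonical_rep f h g \<longleftrightarrow>
     h holomorphic_on unit_disc \<and> g holomorphic_on unit_disc \<and>
     (\<forall>z\<in>unit_disc. f z = h z + cnj (g z)) \<and>
     h 0 = 0 \<and> deriv h 0 = 1 \<and> g 0 = 0"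

definition harmonic_class :: "(complex \<Rightarrow> complex) set" where
  "harmonic_class = {f. \<exists>h g. canonical_rep f h g}"

definition Aut_disc :: "(complex \<Rightarrow> complex) set" where
  "Aut_disc = {\<lambda>z. exp (\<i> * of_real \<theta>) * ((z - a) / (1 - cnj a * z)) |
                 (a::complex) (\<theta>::real). a \<in> unit_disc}"

definition F0_class :: "(complex \<Rightarrow> complex) set" where
  "F0_class = {f \<in> harmonic_class. \<exists>h g. canonical_rep f h g \<and>
     (\<forall>z\<in>unit_disc. deriv h z \<noteq> 0) \<and>
     (\<forall>z\<in>unit_disc. Re (1 + z * deriv (deriv h) z / deriv h z) > 0) \<and>
     (\<exists>\<phi>\<in>Aut_disc. \<forall>z\<in>unit_disc. deriv g z / deriv h z = \<phi> z)}"

text \<open>The Wirtinger derivatives, with \<open>F\<^sub>x\<close> and \<open>F\<^sub>y\<close> the values of the real derivative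
  in the directions \<open>1\<close> and \<open>\<i>\<close>.\<close>

definition wirtinger_z :: "(complex \<Rightarrow> complex) \<Rightarrow> complex \<Rightarrow> complex" where
  "wirtinger_z F z =
     (frechet_derivative F (at z) 1 - \<i> * frechet_derivative F (at z) \<i>) / 2"

definition wirtinger_zbar :: "(complex \<Rightarrow> complex) \<Rightarrow> complex \<Rightarrow> complex" where
  "wirtinger_zbar F z =
     (frechet_derivative F (at z) 1 + \<i> * frechet_derivative F (at z) \<i>) / 2"

definition jacobian :: "(complex \<Rightarrow> complex) \<Rightarrow> complex \<Rightarrow> real" where
  "jacobian f z = (cmod (wirtinger_z f z))\<^sup>2 - (cmod (wirtinger_zbar f z))\<^sup>2"

definition schwarzian :: "(complex \<Rightarrow> complex) \<Rightarrow> complex \<Rightarrow> complex" where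
  "schwarzian f z =
     (let L = (\<lambda>w. complex_of_real (ln (jacobian f w)))
      in wirtinger_z (wirtinger_z L) z - (wirtinger_z L z)\<^sup>2 / 2)"

text \<open>The supremum is taken in the extended reals, so that it is meaningful without
  assuming boundedness.\<close>

definition schwarzian_norm :: "(complex \<Rightarrow> complex) \<Rightarrow> ereal" where
  "schwarzian_norm f =
     (SUP z\<in>unit_disc. ereal ((1 - (cmod z)\<^sup>2)\<^sup>2 * cmod (schwarzian f z)))"

text \<open>The Jacobian is stated through \<open>f\<close> alone; in terms of the canonical representation
  it is \<open>\<bar>h'\<bar>\<^sup>2 - \<bar>g'\<bar>\<^sup>2\<close>.\<close>

lemma canonical_rep_wirtinger:
  assumes "canonical_rep f h g" "z \<in> unit_disc"
  shows "wirtinger_z f z = deriv h z" "wirtinger_zbar f z = cnj (deriv g z)"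
proof -
  have h: "(h has_derivative (\<lambda>t. deriv h z * t)) (at z)"
    and g: "(g has_derivative (\<lambda>t. deriv g z * t)) (at z)"
    using assms holomorphic_derivI[of h unit_disc z] holomorphic_derivI[of g unit_disc z]
    by (auto simp: canonical_rep_def has_field_derivative_def)
  have "((\<lambda>w. h w + cnj (g w)) has_derivative (\<lambda>t. deriv h z * t + cnj (deriv g z * t))) (at z)"
    by (intro has_derivative_add h has_derivative_cnj g)
  then have "(f has_derivative (\<lambda>t. deriv h z * t + cnj (deriv g z * t))) (at z)"
    by (rule has_derivative_transform_within_open[where s = unit_disc])
      (use assms in \<open>auto simp: canonical_rep_def\<close>)
  then have D: "frechet_derivative f (at z) = (\<lambda>t. deriv h z * t + cnj (deriv g z * t))"
    by (rule frechet_derivative_at[symmetric])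
  show "wirtinger_z f z = deriv h z" "wirtinger_zbar f z = cnj (deriv g z)"
    by (simp_all add: wirtinger_z_def wirtinger_zbar_def D algebra_simps)
qed

lemma jacobian_canonical_rep:
  assumes "canonical_rep f h g" "z \<in> unit_disc"
  shows "jacobian f z = (cmod (deriv h z))\<^sup>2 - (cmod (deriv g z))\<^sup>2"
  using canonical_rep_wirtinger[OF assms] by (simp add: jacobian_def)

end

theory Submission
  imports Defs
begin

text \<open>
  Write \<open>P = h''/h'\<close>, let \<open>\<omega>(z) = \<epsilon> (z - a)/(1 - cnj a z)\<close> be the dilatation, and put
  \<open>r = 1 - |z|\<^sup>2\<close>. Because \<open>\<omega>\<close> is an automorphism of the disc, \<open>1 - |\<omega>|\<^sup>2\<close> factors as
  \<open>(1 - |a|\<^sup>2) r / |1 - cnj a z|\<^sup>2\<close>, so \<open>log J\<^sub>f\<close> is a sum of four logarithms whose Wirtinger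
  derivatives are elementary (\<open>schwarzian_disc_automorphism_dilatation\<close>). With
  \<open>A = (r P - 2 cnj z)/2\<close> and \<open>Q = cnj (z - a)/(1 - cnj a z)\<close> the result reads
  \<open>r\<^sup>2 S\<^sub>f = r\<^sup>2 S\<^sub>h + 2 A Q + Q\<^sup>2/2\<close>, where \<open>|Q| < 1\<close>.

  Convexity of \<open>h\<close> enters through one inequality, \<open>r\<^sup>2 |S\<^sub>h| \<le> 2 (1 - |A|\<^sup>2)\<close>
  (\<open>convex_schwarzian_bound\<close>). At \<open>z = 0\<close> it is the coefficient inequality
  \<open>|a\<^sub>3 - a\<^sub>2\<^sup>2| \<le> (1 - |a\<^sub>2|\<^sup>2)/3\<close> for convex functions, and in general it is the Schwarz--Pick
  inequality for \<open>\<phi> = P/(2 + z P)\<close>, which maps the disc into its closure. With \<open>x = |A|\<close> it follows that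
  \<open>r\<^sup>2 |S\<^sub>f| \<le> 2 (1 - x\<^sup>2) + 2 x + 1/2 = 3 - 2 (x - 1/2)\<^sup>2 \<le> 3\<close>.

  Equality is approached when \<open>x = 1/2\<close>, \<open>|Q|\<close> tends to \<open>1\<close>, Schwarz--Pick is an equality and the
  three terms have the same argument. At \<open>z = 0\<close> this singles out, up to rotation,
  \<open>\<phi>(z) = (z + 1/2)/(1 + z/2)\<close>, that is \<open>P(z) = (1 + 2 z)/(1 - z\<^sup>2)\<close>, together with
  \<open>a = - q\<close> for \<open>q\<close> close to \<open>1\<close>; there \<open>S\<^sub>f(0) = 3/2 + q + q\<^sup>2/2\<close>
  (\<open>F0_class_schwarzian_near_3\<close>).
\<close>

section \<open>Wirtinger derivatives of logarithms\<close>

text \<open>A real-linear map of the plane is \<open>t \<mapsto> \<alpha> t + \<beta> cnj t\<close> for unique \<open>\<alpha>\<close> and \<open>\<beta>\<close>, and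
  \<open>wirtinger_z\<close> reads off \<open>\<alpha>\<close>. The function \<open>G\<close> is there because the formulas below are valid on
  the disc only.\<close>

lemma wirtinger_z_local:
  assumes "(G has_derivative (\<lambda>t. \<alpha> * t + \<beta> * cnj t)) (at z)"
    and "open S" "z \<in> S" "\<And>w. w \<in> S \<Longrightarrow> F w = G w"
  shows "wirtinger_z F z = \<alpha>"
proof -
  have "(F has_derivative (\<lambda>t. \<alpha> * t + \<beta> * cnj t)) (at z)"
    by (rule has_derivative_transform_within_open[OF assms(1-3)]) (simp add: assms(4))
  then have "frechet_derivative F (at z) = (\<lambda>t. \<alpha> * t + \<beta> * cnj t)"
    by (rule frechet_derivative_at[symmetric])
  then show ?thesis
    by (simp add: wirtinger_z_def algebra_simps)
qed

text \<open>Since \<open>log |k|\<^sup>2\<close> is locally \<open>log k + cnj (log k)\<close>, its \<open>z\<close>-derivative is the logarithmic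
  derivative of \<open>k\<close>. Differentiating \<open>|k|\<^sup>2\<close> directly avoids the choice of a branch.\<close>

lemma has_derivative_ln_norm_sq:
  assumes "(k has_field_derivative k') (at z)" "k z \<noteq> 0"
  shows "((\<lambda>w. complex_of_real (ln ((cmod (k w))\<^sup>2))) has_derivative
           (\<lambda>t. k' / k z * t + cnj (k' / k z) * cnj t)) (at z)"
proof -
  have k: "(k has_derivative (\<lambda>t. k' * t)) (at z)"
    using assms(1) by (simp add: has_field_derivative_def)
  have "((\<lambda>w. (cmod (k w))\<^sup>2) has_derivative (\<lambda>t. 2 * (k z \<bullet> (k' * t)))) (at z)"
    using has_derivative_compose[OF k has_derivative_sqnorm_at] by (simp add: o_def)
  then have "((\<lambda>w. ln ((cmod (k w))\<^sup>2)) has_derivative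
      (\<lambda>t. (2 * (k z \<bullet> (k' * t))) * inverse ((cmod (k z))\<^sup>2))) (at z)"
    by (rule has_derivative_ln[rotated]) (use assms(2) in simp)
  then have *: "((\<lambda>w. complex_of_real (ln ((cmod (k w))\<^sup>2))) has_derivative
      (\<lambda>t. complex_of_real ((2 * (k z \<bullet> (k' * t))) * inverse ((cmod (k z))\<^sup>2)))) (at z)"
    by (rule has_derivative_of_real)
  have "complex_of_real ((2 * (k z \<bullet> (k' * t))) * inverse ((cmod (k z))\<^sup>2))
      = k' / k z * t + cnj (k' / k z) * cnj t" for t
  proof -
    have "complex_of_real (2 * (k z \<bullet> (k' * t))) = cnj (k z) * (k' * t) + k z * cnj (k' * t)"
      by (simp add: complex_eq_iff inner_complex_def algebra_simps)
    moreover have "complex_of_real ((cmod (k z))\<^sup>2) = k z * cnj (k z)"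
      by (rule complex_norm_square)
    ultimately show ?thesis
      using assms(2) by (simp add: field_simps)
  qed
  then show ?thesis using * by simp
qed

lemma has_derivative_ln_one_minus_norm_sq:
  assumes "cmod z < 1"
  shows "((\<lambda>w. complex_of_real (ln (1 - (cmod w)\<^sup>2))) has_derivative
           (\<lambda>t. - (cnj z / (1 - z * cnj z)) * t + cnj (- (cnj z / (1 - z * cnj z))) * cnj t)) (at z)"
proof -
  have pos: "0 < 1 - (cmod z)\<^sup>2"
    using assms by (simp add: power_less_one_iff abs_square_less_1)
  have "((\<lambda>w. 1 - (cmod w)\<^sup>2) has_derivative (\<lambda>t. - (2 * (z \<bullet> t)))) (at z)"
    by (auto intro!: derivative_eq_intros)
  then have "((\<lambda>w. ln (1 - (cmod w)\<^sup>2)) has_derivative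
      (\<lambda>t. - (2 * (z \<bullet> t)) * inverse (1 - (cmod z)\<^sup>2))) (at z)"
    by (rule has_derivative_ln[rotated]) (use pos in simp)
  then have *: "((\<lambda>w. complex_of_real (ln (1 - (cmod w)\<^sup>2))) has_derivative
      (\<lambda>t. complex_of_real (- (2 * (z \<bullet> t)) * inverse (1 - (cmod z)\<^sup>2)))) (at z)"
    by (rule has_derivative_of_real)
  have "complex_of_real (- (2 * (z \<bullet> t)) * inverse (1 - (cmod z)\<^sup>2))
      = - (cnj z / (1 - z * cnj z)) * t + cnj (- (cnj z / (1 - z * cnj z))) * cnj t" for t
  proof -
    have 1: "complex_of_real (2 * (z \<bullet> t)) = cnj z * t + z * cnj t"
      by (simp add: complex_eq_iff inner_complex_def algebra_simps)
    have 2: "complex_of_real (1 - (cmod z)\<^sup>2) = 1 - z * cnj z"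
      unfolding of_real_diff of_real_1 complex_norm_square ..
    have "complex_of_real (- (2 * (z \<bullet> t)) * inverse (1 - (cmod z)\<^sup>2))
       = - (cnj z * t + z * cnj t) / (1 - z * cnj z)"
      by (simp only: of_real_mult of_real_minus of_real_inverse 1[unfolded of_real_mult] 2 divide_inverse)
    then show ?thesis
      by (simp add: divide_inverse algebra_simps)
  qed
  then show ?thesis using * by simp
qed

section \<open>Disc automorphisms and the Schwarz--Pick inequality\<close>

lemma moebius_norm_identity:
  "(cmod (1 - cnj a * z))\<^sup>2 - (cmod (z - a))\<^sup>2 = (1 - (cmod a)\<^sup>2) * (1 - (cmod z)\<^sup>2)"
  unfolding cmod_power2 by (simp add: power2_eq_square algebra_simps)

lemma one_minus_cnj_mult_nonzero:
  assumes "cmod a < 1" "cmod z < 1"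
  shows "1 - cnj a * z \<noteq> 0"
proof -
  have "cmod (cnj a * z) < 1"
    using mult_strict_mono'[OF assms] by (simp add: norm_mult)
  then show ?thesis by auto
qed

lemma moebius_norm_less_1:
  assumes "cmod a < 1" "cmod z < 1"
  shows "cmod ((z - a) / (1 - cnj a * z)) < 1"
proof -
  have "0 < (1 - (cmod a)\<^sup>2) * (1 - (cmod z)\<^sup>2)"
    using assms by (simp add: power_less_one_iff abs_square_less_1)
  then have "(cmod (z - a))\<^sup>2 < (cmod (1 - cnj a * z))\<^sup>2"
    using moebius_norm_identity[of a z] by linarith
  then have "cmod (z - a) < cmod (1 - cnj a * z)"
    by (rule power_less_imp_less_base) simp
  then show ?thesis
    using one_minus_cnj_mult_nonzero[OF assms] by (simp add: norm_divide)
qed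

text \<open>Unless \<open>\<phi>\<close> attains modulus \<open>1\<close>, in which case it is constant, pre- and postcomposition with
  disc automorphisms turn \<open>\<phi>\<close> into a self-map \<open>F\<close> fixing \<open>0\<close>, and the inequality becomes
  \<open>|F'(0)| \<le> 1\<close>. Allowing \<open>|\<phi>| = 1\<close> matters later: \<open>\<phi>\<close> is a unimodular constant when \<open>h\<close> maps
  the disc onto a half-plane.\<close>

lemma Schwarz_Pick_deriv:
  assumes hol: "\<phi> holomorphic_on unit_disc"
    and le: "\<And>w. w \<in> unit_disc \<Longrightarrow> cmod (\<phi> w) \<le> 1" and z: "z \<in> unit_disc"
  shows "(1 - (cmod z)\<^sup>2) * cmod (deriv \<phi> z) \<le> 1 - (cmod (\<phi> z))\<^sup>2"
proof (cases "\<exists>w\<in>unit_disc. cmod (\<phi> w) = 1")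
  case True
  then obtain w where w: "w \<in> unit_disc" "cmod (\<phi> w) = 1" by blast
  have "\<phi> constant_on unit_disc"
    by (rule maximum_modulus_principle[OF hol, where U = unit_disc and \<xi> = w]) (use w le in auto)
  then obtain c where c: "\<And>y. y \<in> unit_disc \<Longrightarrow> \<phi> y = c"
    unfolding constant_on_def by blast
  have "((\<lambda>_. c) has_field_derivative 0) (at z)" by simp
  then have "(\<phi> has_field_derivative 0) (at z)"
    by (rule has_field_derivative_transform_within_open[where S = unit_disc]) (use z c in auto)
  then have "deriv \<phi> z = 0" by (rule DERIV_imp_deriv)
  then show ?thesis using le[OF z] by (simp add: power_le_one)
next
  case False
  then have lt: "\<And>w. w \<in> unit_disc \<Longrightarrow> cmod (\<phi> w) < 1"
    using le by (force simp: less_le)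
  define b where "b = \<phi> z"
  define T where "T = (\<lambda>w. (w + z) / (1 + cnj z * w))"
  define F where "F = (\<lambda>w. (\<phi> (T w) - b) / (1 - cnj b * \<phi> (T w)))"
  have z1: "cmod z < 1" and b1: "cmod b < 1" using z lt by (auto simp: b_def)
  have pz: "1 - (cmod z)\<^sup>2 > 0" and pb: "1 - (cmod b)\<^sup>2 > 0"
    using z1 b1 by (simp_all add: power_less_one_iff abs_square_less_1)
  have T1: "T w \<in> unit_disc" if "w \<in> unit_disc" for w
    using moebius_norm_less_1[of "-z" w] that z1 by (simp add: T_def)
  have Tnz: "1 + cnj z * w \<noteq> 0" if "w \<in> unit_disc" for w
    using one_minus_cnj_mult_nonzero[of "-z" w] that z1 by simp
  have Tnz': "1 - cnj b * \<phi> (T w) \<noteq> 0" if "w \<in> unit_disc" for w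
    using one_minus_cnj_mult_nonzero[OF b1] lt T1 that by blast
  have holT: "T holomorphic_on unit_disc"
    unfolding T_def using Tnz by (auto intro!: holomorphic_intros)
  have hol2: "(\<lambda>w. \<phi> (T w)) holomorphic_on unit_disc"
  proof -
    have "T ` unit_disc \<subseteq> unit_disc" using T1 by blast
    from holomorphic_on_compose_gen[OF holT hol this] show ?thesis by (simp add: o_def)
  qed
  have holF: "F holomorphic_on unit_disc"
    unfolding F_def using hol2 Tnz' by (auto intro!: holomorphic_intros)
  have T0: "T 0 = z" by (simp add: T_def)
  have F0: "F 0 = 0" by (simp add: F_def T0 b_def)
  have Flt: "cmod (F w) < 1" if "cmod w < 1" for w
    unfolding F_def using moebius_norm_less_1[OF b1] lt T1 that by simp
  have "cmod (deriv F 0) \<le> 1"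
    by (rule Schwarz_Lemma(2)[OF holF F0 Flt, of 0]) auto
  moreover have "(F has_field_derivative
      deriv \<phi> z * complex_of_real (1 - (cmod z)\<^sup>2) / complex_of_real (1 - (cmod b)\<^sup>2)) (at 0)"
  proof -
    have dT: "(T has_field_derivative complex_of_real (1 - (cmod z)\<^sup>2)) (at 0)"
      unfolding T_def of_real_diff of_real_1 complex_norm_square
      by (auto intro!: derivative_eq_intros)
    have d\<phi>: "(\<phi> has_field_derivative deriv \<phi> z) (at (T 0))"
      using holomorphic_derivI[OF hol open_ball z] by (simp add: T0)
    have d2: "((\<lambda>w. \<phi> (T w)) has_field_derivative deriv \<phi> z * complex_of_real (1 - (cmod z)\<^sup>2)) (at 0)"
      using DERIV_chain2[OF d\<phi> dT] .
    have nb: "1 - cnj b * b \<noteq> 0" using one_minus_cnj_mult_nonzero[OF b1 b1] .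
    have bb: "\<phi> (T 0) = b" by (simp add: T0 b_def)
    have cb: "complex_of_real (1 - (cmod b)\<^sup>2) = 1 - cnj b * b"
      unfolding of_real_diff of_real_1 complex_norm_square by (simp add: mult.commute)
    let ?d = "deriv \<phi> z * complex_of_real (1 - (cmod z)\<^sup>2)"
    have dN: "((\<lambda>w. \<phi> (T w) - b) has_field_derivative ?d) (at 0)"
      using DERIV_diff[OF d2 DERIV_const[of b]] by simp
    have dM: "((\<lambda>w. 1 - cnj b * \<phi> (T w)) has_field_derivative - (cnj b * ?d)) (at 0)"
      using DERIV_diff[OF DERIV_const[of 1] DERIV_cmult[OF d2, of "cnj b"]] by simp
    have "1 - cnj b * \<phi> (T 0) \<noteq> 0" using nb bb by simp
    from DERIV_divide[OF dN dM this] show ?thesis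
      unfolding F_def cb bb using nb by simp
  qed
  ultimately have "cmod (deriv \<phi> z) * (1 - (cmod z)\<^sup>2) / (1 - (cmod b)\<^sup>2) \<le> 1"
    using pz pb by (simp add: DERIV_imp_deriv norm_mult norm_divide del: of_real_diff)
  then show ?thesis using pb by (simp add: b_def field_simps)
qed

section \<open>The Schwarzian derivative when the dilatation is a disc automorphism\<close>

text \<open>Factoring \<open>1 - |\<omega>|\<^sup>2\<close> gives
  \<open>log J\<^sub>f = log |h'|\<^sup>2 + log (1 - |z|\<^sup>2) - log |1 - cnj a z|\<^sup>2 + log (1 - |a|\<^sup>2)\<close> on the whole
  disc, so its first \<open>z\<close>-derivative \<open>K\<close> is explicit there and can be differentiated once more.\<close>

lemma schwarzian_disc_automorphism_dilatation:
  fixes a \<epsilon> :: complex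
  assumes rep: "canonical_rep f h g"
    and h': "\<And>z. z \<in> unit_disc \<Longrightarrow> deriv h z \<noteq> 0"
    and holP: "P holomorphic_on unit_disc"
    and h'': "\<And>z. z \<in> unit_disc \<Longrightarrow> deriv (deriv h) z = P z * deriv h z"
    and dil: "\<And>z. z \<in> unit_disc \<Longrightarrow>
                deriv g z = \<epsilon> * ((z - a) / (1 - cnj a * z)) * deriv h z"
    and \<epsilon>: "cmod \<epsilon> = 1" and a: "cmod a < 1" and z: "z \<in> unit_disc"
  shows "schwarzian f z =
    deriv P z - (cnj z / (1 - z * cnj z))\<^sup>2 + (cnj a / (1 - cnj a * z))\<^sup>2
    - (P z - cnj z / (1 - z * cnj z) + cnj a / (1 - cnj a * z))\<^sup>2 / 2"
proof -
  have hol: "h holomorphic_on unit_disc"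
    using rep by (simp add: canonical_rep_def)
  then have hol': "deriv h holomorphic_on unit_disc"
    by (auto intro: holomorphic_deriv)
  define L where "L = (\<lambda>w. complex_of_real (ln (jacobian f w)))"
  define G where "G = (\<lambda>w. complex_of_real (ln ((cmod (deriv h w))\<^sup>2))
      + complex_of_real (ln (1 - (cmod w)\<^sup>2))
      - complex_of_real (ln ((cmod (1 - cnj a * w))\<^sup>2))
      + complex_of_real (ln (1 - (cmod a)\<^sup>2)))"
  define K where "K = (\<lambda>w. P w - cnj w / (1 - w * cnj w) + cnj a / (1 - cnj a * w))"
  have LG: "L w = G w" if w: "w \<in> unit_disc" for w
  proof -
    have nz: "1 - cnj a * w \<noteq> 0"
      using one_minus_cnj_mult_nonzero a w by simp
    have pos: "1 - (cmod a)\<^sup>2 > 0" "1 - (cmod w)\<^sup>2 > 0"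
      using a w by (simp_all add: power_less_one_iff abs_square_less_1)
    have "jacobian f w = (cmod (deriv h w))\<^sup>2 * (1 - (cmod (w - a))\<^sup>2 / (cmod (1 - cnj a * w))\<^sup>2)"
      unfolding jacobian_canonical_rep[OF rep w] dil[OF w] norm_mult norm_divide \<epsilon>
      by (simp add: power_mult_distrib power_divide right_diff_distrib)
    also have "\<dots> = (cmod (deriv h w))\<^sup>2 *
        ((1 - (cmod a)\<^sup>2) * (1 - (cmod w)\<^sup>2) / (cmod (1 - cnj a * w))\<^sup>2)"
      using nz by (simp add: moebius_norm_identity[symmetric] diff_divide_distrib)
    finally show ?thesis
      using nz pos h'[OF w] unfolding L_def G_def
      by (simp add: ln_mult ln_div)
  qed
  have Lz: "wirtinger_z L w = K w" if w: "w \<in> unit_disc" for w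
  proof -
    have nz: "1 - cnj a * w \<noteq> 0"
      using one_minus_cnj_mult_nonzero a w by simp
    let ?p = "P w" and ?u = "- (cnj w / (1 - w * cnj w))" and ?v = "- cnj a / (1 - cnj a * w)"
    have 1: "((\<lambda>w. complex_of_real (ln ((cmod (deriv h w))\<^sup>2))) has_derivative
        (\<lambda>t. ?p * t + cnj ?p * cnj t)) (at w)"
      using has_derivative_ln_norm_sq[OF holomorphic_derivI[OF hol' open_ball w] h'[OF w]]
        h''[OF w] h'[OF w] by simp
    have 2: "((\<lambda>w. complex_of_real (ln (1 - (cmod w)\<^sup>2))) has_derivative
        (\<lambda>t. ?u * t + cnj ?u * cnj t)) (at w)"
      by (rule has_derivative_ln_one_minus_norm_sq) (use w in simp)
    have 3: "((\<lambda>w. complex_of_real (ln ((cmod (1 - cnj a * w))\<^sup>2))) has_derivative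
        (\<lambda>t. ?v * t + cnj ?v * cnj t)) (at w)"
      by (rule has_derivative_ln_norm_sq) (use nz in \<open>auto intro!: derivative_eq_intros\<close>)
    have "(G has_derivative (\<lambda>t. (?p * t + cnj ?p * cnj t) + (?u * t + cnj ?u * cnj t)
        - (?v * t + cnj ?v * cnj t) + 0)) (at w)"
      unfolding G_def
      by (intro has_derivative_add has_derivative_diff 1 2 3 has_derivative_const)
    also have "(\<lambda>t. (?p * t + cnj ?p * cnj t) + (?u * t + cnj ?u * cnj t)
        - (?v * t + cnj ?v * cnj t) + 0)
        = (\<lambda>t. (?p + ?u - ?v) * t + cnj (?p + ?u - ?v) * cnj t)"
      by (rule ext) (simp add: algebra_simps)
    finally have "wirtinger_z L w = ?p + ?u - ?v"
      by (rule wirtinger_z_local[where S = unit_disc]) (use w LG in auto)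
    then show ?thesis by (simp add: K_def)
  qed
  have nz: "1 - cnj a * z \<noteq> 0"
    using one_minus_cnj_mult_nonzero a z by simp
  have nz2: "1 - z * cnj z \<noteq> 0"
    using one_minus_cnj_mult_nonzero[of z z] z by (simp add: mult.commute)
  define r where "r = 1 - z * cnj z"
  define V where "V = (cnj a / (1 - cnj a * z))\<^sup>2"
  have 1: "(P has_derivative (\<lambda>t. deriv P z * t)) (at z)"
    using holomorphic_derivI[OF holP open_ball z] by (simp add: has_field_derivative_def)
  have 2: "((\<lambda>w. cnj w / (1 - w * cnj w)) has_derivative
      (\<lambda>t. (cnj z / r)\<^sup>2 * t + (1 / r\<^sup>2) * cnj t)) (at z)"
  proof (rule has_derivative_eq_rhs[OF has_derivative_divide'])
    show "(cnj has_derivative cnj) (at z)"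
      using has_derivative_cnj[OF has_derivative_ident] by simp
    show "((\<lambda>w. 1 - w * cnj w) has_derivative (\<lambda>t. - (t * cnj z + z * cnj t))) (at z)"
      by (auto intro!: derivative_eq_intros has_derivative_cnj)
    have "cnj t * (1 - z * cnj z) - cnj z * - (t * cnj z + z * cnj t)
        = (cnj z)\<^sup>2 * t + cnj t" for t
      by (simp add: algebra_simps power2_eq_square)
    then show "(\<lambda>t. (cnj t * (1 - z * cnj z) - cnj z * - (t * cnj z + z * cnj t))
          / ((1 - z * cnj z) * (1 - z * cnj z)))
        = (\<lambda>t. (cnj z / r)\<^sup>2 * t + (1 / r\<^sup>2) * cnj t)"
      unfolding r_def[symmetric]
      by (simp only:) (simp add: add_divide_distrib power_divide power2_eq_square[of r])
  qed (rule nz2)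
  have "((\<lambda>w. cnj a / (1 - cnj a * w)) has_field_derivative V) (at z)"
  proof -
    have "((\<lambda>w. 1 - cnj a * w) has_field_derivative - cnj a) (at z)"
      by (auto intro!: derivative_eq_intros)
    from DERIV_divide[OF DERIV_const this nz, of "cnj a"] show ?thesis
      by (simp add: V_def power2_eq_square)
  qed
  then have 3: "((\<lambda>w. cnj a / (1 - cnj a * w)) has_derivative (\<lambda>t. V * t)) (at z)"
    by (simp add: has_field_derivative_def)
  have "(K has_derivative (\<lambda>t. deriv P z * t
      - ((cnj z / r)\<^sup>2 * t + (1 / r\<^sup>2) * cnj t) + V * t)) (at z)"
    unfolding K_def by (intro has_derivative_add has_derivative_diff 1 2 3)
  also have "(\<lambda>t. deriv P z * t - ((cnj z / r)\<^sup>2 * t + (1 / r\<^sup>2) * cnj t) + V * t)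
      = (\<lambda>t. (deriv P z - (cnj z / r)\<^sup>2 + V) * t + (- (1 / r\<^sup>2)) * cnj t)"
    unfolding distrib_right left_diff_distrib by (rule ext) simp
  finally have "wirtinger_z (wirtinger_z L) z
      = deriv P z - (cnj z / r)\<^sup>2 + V"
    by (rule wirtinger_z_local[where S = unit_disc]) (use z Lz in auto)
  then show ?thesis
    using Lz[OF z] by (simp add: schwarzian_def L_def[symmetric] K_def r_def V_def)
qed

section \<open>The bound\<close>

text \<open>The hypothesis on \<open>1 + w P(w)\<close> says that \<open>F(w) = w P(w)/(2 + w P(w))\<close>, its Cayley transform,
  maps the disc into itself; as \<open>F\<close> fixes \<open>0\<close>, the Schwarz lemma shows that \<open>\<phi>(w) = F(w)/w\<close> is
  bounded by \<open>1\<close>. With \<open>D = 2 + w P\<close> one has \<open>P' - P\<^sup>2/2 = \<phi>' D\<^sup>2/2\<close> and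
  \<open>A = D (\<phi> - cnj z)/2\<close>, while \<open>D (1 - z \<phi>) = 2\<close>. So the claim is the Schwarz--Pick inequality
  for \<open>\<phi>\<close> multiplied by \<open>(1 - |z|\<^sup>2) |D|\<^sup>2/2\<close>.\<close>

lemma convex_schwarzian_bound:
  assumes hol: "P holomorphic_on unit_disc"
    and conv: "\<And>w. w \<in> unit_disc \<Longrightarrow> Re (1 + w * P w) > 0" and z: "z \<in> unit_disc"
  defines "A \<equiv> (complex_of_real (1 - (cmod z)\<^sup>2) * P z - 2 * cnj z) / 2"
  shows "(1 - (cmod z)\<^sup>2)\<^sup>2 * cmod (deriv P z - (P z)\<^sup>2 / 2) \<le> 2 * (1 - (cmod A)\<^sup>2)"
proof -
  define D where "D = (\<lambda>w. 2 + w * P w)"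
  define \<phi> where "\<phi> = (\<lambda>w. P w / D w)"
  define F where "F = (\<lambda>w. w * \<phi> w)"
  have ReD: "Re (D w) > 1" if "w \<in> unit_disc" for w
    using conv[OF that] by (simp add: D_def)
  then have Dnz: "D w \<noteq> 0" if "w \<in> unit_disc" for w
    using that by fastforce
  have holD: "D holomorphic_on unit_disc"
    unfolding D_def using hol by (auto intro!: holomorphic_intros)
  have hol\<phi>: "\<phi> holomorphic_on unit_disc"
    unfolding \<phi>_def using hol holD Dnz by (auto intro!: holomorphic_intros)
  have holF: "F holomorphic_on unit_disc"
    unfolding F_def using hol\<phi> by (auto intro!: holomorphic_intros)
  have Flt: "cmod (F w) < 1" if "cmod w < 1" for w
  proof -
    have w: "w \<in> unit_disc" using that by simp
    have "(cmod (w * P w))\<^sup>2 < (cmod (D w))\<^sup>2"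
      using conv[OF w] unfolding cmod_power2 D_def
      by (simp add: power2_eq_square algebra_simps)
    then have "cmod (w * P w) < cmod (D w)"
      by (rule power_less_imp_less_base) simp
    then show ?thesis
      using Dnz[OF w] by (simp add: F_def \<phi>_def norm_divide norm_mult)
  qed
  have F0: "F 0 = 0" by (simp add: F_def)
  have dF0: "deriv F 0 = \<phi> 0"
  proof -
    have "(\<phi> has_field_derivative deriv \<phi> 0) (at 0)"
      by (rule holomorphic_derivI[OF hol\<phi>]) auto
    then have "(F has_field_derivative \<phi> 0) (at 0)"
      unfolding F_def by (auto intro!: derivative_eq_intros)
    then show ?thesis by (rule DERIV_imp_deriv)
  qed
  have \<phi>le: "cmod (\<phi> w) \<le> 1" if "w \<in> unit_disc" for w
  proof (cases "w = 0")
    case True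
    then show ?thesis using Schwarz_Lemma(2)[OF holF F0 Flt, of 0] dF0 by simp
  next
    case False
    have "cmod w * cmod (\<phi> w) \<le> cmod w"
      using Schwarz_Lemma(1)[OF holF F0 Flt, of w] that by (simp add: F_def norm_mult)
    then show ?thesis using False by simp
  qed
  let ?r = "1 - (cmod z)\<^sup>2"
  have z1: "cmod z < 1" using z by simp
  have r: "?r > 0" using z1 by (simp add: power_less_one_iff abs_square_less_1)
  have Dz: "D z \<noteq> 0" using Dnz z by blast
  have dP: "(P has_field_derivative deriv P z) (at z)"
    by (rule holomorphic_derivI[OF hol open_ball z])
  have dD: "(D has_field_derivative P z + z * deriv P z) (at z)"
    unfolding D_def by (auto intro!: derivative_eq_intros dP)
  have "deriv P z * D z - P z * (P z + z * deriv P z) = 2 * (deriv P z - (P z)\<^sup>2 / 2)"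
    by (simp add: D_def algebra_simps power2_eq_square)
  then have "(\<phi> has_field_derivative 2 * (deriv P z - (P z)\<^sup>2 / 2) / (D z)\<^sup>2) (at z)"
    using DERIV_divide[OF dP dD Dz] by (simp add: \<phi>_def power2_eq_square)
  then have d\<phi>: "deriv \<phi> z = 2 * (deriv P z - (P z)\<^sup>2 / 2) / (D z)\<^sup>2"
    by (rule DERIV_imp_deriv)
  have S: "cmod (deriv P z - (P z)\<^sup>2 / 2) = cmod (deriv \<phi> z) * (cmod (D z))\<^sup>2 / 2"
    using Dz unfolding d\<phi> norm_mult norm_divide norm_power norm_numeral by simp
  have A: "A = D z * (\<phi> z - cnj z) / 2"
  proof -
    have "D z * (\<phi> z - cnj z) = P z - D z * cnj z"
      using Dz by (simp add: \<phi>_def right_diff_distrib)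
    also have "\<dots> = (1 - z * cnj z) * P z - 2 * cnj z"
      by (simp add: D_def algebra_simps)
    finally show ?thesis
      unfolding A_def of_real_diff of_real_1 complex_norm_square by simp
  qed
  have two: "2 = D z * (1 - z * \<phi> z)"
    using Dz by (simp add: \<phi>_def right_diff_distrib) (simp add: D_def)
  have "4 = (cmod (D z))\<^sup>2 * (cmod (1 - z * \<phi> z))\<^sup>2"
    using arg_cong[OF two, of "\<lambda>x. (cmod x)\<^sup>2"] by (simp add: norm_mult power_mult_distrib)
  moreover have "4 * (cmod A)\<^sup>2 = (cmod (D z))\<^sup>2 * (cmod (\<phi> z - cnj z))\<^sup>2"
    unfolding A by (simp add: norm_mult norm_divide power_mult_distrib power_divide)
  ultimately have "4 * (1 - (cmod A)\<^sup>2)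
      = (cmod (D z))\<^sup>2 * ((cmod (1 - z * \<phi> z))\<^sup>2 - (cmod (\<phi> z - cnj z))\<^sup>2)"
    by (simp add: right_diff_distrib)
  then have A_gap: "(cmod (D z))\<^sup>2 * (?r * (1 - (cmod (\<phi> z))\<^sup>2)) = 4 * (1 - (cmod A)\<^sup>2)"
    using moebius_norm_identity[of "cnj z" "\<phi> z"] by simp
  have "?r\<^sup>2 * cmod (deriv P z - (P z)\<^sup>2 / 2)
      = (cmod (D z))\<^sup>2 * ?r / 2 * (?r * cmod (deriv \<phi> z))"
    unfolding S by (simp add: power2_eq_square)
  also have "\<dots> \<le> (cmod (D z))\<^sup>2 * ?r / 2 * (1 - (cmod (\<phi> z))\<^sup>2)"
    by (rule mult_left_mono[OF Schwarz_Pick_deriv[OF hol\<phi> \<phi>le z]]) (use r in simp_all)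
  also have "\<dots> = (cmod (D z))\<^sup>2 * (?r * (1 - (cmod (\<phi> z))\<^sup>2)) / 2"
    by simp
  also have "\<dots> = 2 * (1 - (cmod A)\<^sup>2)"
    unfolding A_gap by simp
  finally show ?thesis .
qed

text \<open>Multiplying the formula for \<open>S\<^sub>f\<close> by \<open>r\<^sup>2\<close> and using \<open>r (u - v) = Q\<close>, where \<open>u = cnj z/r\<close> and
  \<open>v = cnj a/(1 - cnj a z)\<close>, leaves \<open>r\<^sup>2 S\<^sub>h + 2 A Q + Q\<^sup>2/2\<close>. With
  \<open>|Q| \<le> 1\<close> the triangle inequality gives \<open>5/2 + 2 x - 2 x\<^sup>2\<close>, where \<open>x = |A|\<close>; its maximum,
  at \<open>x = 1/2\<close>, is \<open>3\<close>.\<close>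

lemma schwarzian_pointwise_bound:
  fixes P P' a z :: complex
  assumes a: "cmod a < 1" and z: "cmod z < 1"
  defines "A \<equiv> (complex_of_real (1 - (cmod z)\<^sup>2) * P - 2 * cnj z) / 2"
  assumes S: "(1 - (cmod z)\<^sup>2)\<^sup>2 * cmod (P' - P\<^sup>2 / 2) \<le> 2 * (1 - (cmod A)\<^sup>2)"
  shows "(1 - (cmod z)\<^sup>2)\<^sup>2 *
    cmod (P' - (cnj z / (1 - z * cnj z))\<^sup>2 + (cnj a / (1 - cnj a * z))\<^sup>2
    - (P - cnj z / (1 - z * cnj z) + cnj a / (1 - cnj a * z))\<^sup>2 / 2) \<le> 3"
proof -
  define r where "r = 1 - z * cnj z"
  define d where "d = 1 - cnj a * z"
  define Q where "Q = cnj (z - a) / d"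
  define u where "u = cnj z / r"
  define v where "v = cnj a / d"
  define x y where "x = cmod A" and "y = cmod Q"
  have r_real: "r = complex_of_real (1 - (cmod z)\<^sup>2)"
    unfolding r_def of_real_diff of_real_1 complex_norm_square ..
  have rpos: "1 - (cmod z)\<^sup>2 > 0" "1 - (cmod a)\<^sup>2 > 0"
    using z a by (simp_all add: power_less_one_iff abs_square_less_1)
  have r0: "r \<noteq> 0"
    using one_minus_cnj_mult_nonzero[OF z z] by (simp add: r_def mult.commute)
  have d0: "d \<noteq> 0"
    using one_minus_cnj_mult_nonzero[OF a z] by (simp add: d_def)
  have nr: "cmod r = 1 - (cmod z)\<^sup>2"
    unfolding r_real norm_of_real using rpos by simp
  have ru: "r * u = cnj z" using r0 by (simp add: u_def)
  have q: "r * (u - v) = Q"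
    using r0 d0 by (simp add: u_def v_def Q_def field_simps) (simp add: r_def d_def algebra_simps)
  have A2: "2 * A = r * P - 2 * (r * u)"
    unfolding A_def r_real[symmetric] ru by simp
  have "r\<^sup>2 * (P' - u\<^sup>2 + v\<^sup>2 - (P - u + v)\<^sup>2 / 2)
      = r\<^sup>2 * (P' - P\<^sup>2 / 2) + (2 * A) * Q + Q\<^sup>2 / 2"
    unfolding A2 q[symmetric] by (simp add: power2_eq_square field_simps)
  also have "cmod \<dots> \<le> cmod (r\<^sup>2 * (P' - P\<^sup>2 / 2)) + cmod ((2 * A) * Q) + cmod (Q\<^sup>2 / 2)"
    by (rule norm_triangle_le) (intro add_right_mono norm_triangle_ineq)
  also have "\<dots> \<le> 2 * (1 - x\<^sup>2) + 2 * x * y + y\<^sup>2 / 2"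
    using S by (simp add: norm_mult norm_power norm_divide nr x_def y_def)
  also have "\<dots> \<le> 2 * (1 - x\<^sup>2) + 2 * x * 1 + 1\<^sup>2 / 2"
  proof -
    have "y = cmod ((z - a) / (1 - cnj a * z))"
      unfolding y_def Q_def d_def norm_divide complex_mod_cnj ..
    then have "y \<le> 1"
      using moebius_norm_less_1[OF a z] by simp
    moreover have "0 \<le> y" "0 \<le> x" by (simp_all add: x_def y_def)
    ultimately show ?thesis
      by (intro add_mono mult_left_mono divide_right_mono power_mono order_refl) auto
  qed
  also have "\<dots> \<le> 3"
    using zero_le_power2[of "2 * x - 1"] by (simp add: power2_eq_square algebra_simps)
  finally show ?thesis
    unfolding norm_mult norm_power nr unfolding u_def v_def r_def d_def .
qed

lemma schwarzian_norm_F0_class_le: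
  assumes "f \<in> F0_class"
  shows "schwarzian_norm f \<le> 3"
proof -
  obtain h g \<phi> where rep: "canonical_rep f h g"
    and h': "\<And>z. z \<in> unit_disc \<Longrightarrow> deriv h z \<noteq> 0"
    and conv: "\<And>z. z \<in> unit_disc \<Longrightarrow> Re (1 + z * deriv (deriv h) z / deriv h z) > 0"
    and \<phi>: "\<phi> \<in> Aut_disc" and dil: "\<And>z. z \<in> unit_disc \<Longrightarrow> deriv g z / deriv h z = \<phi> z"
    using assms unfolding F0_class_def by blast
  obtain a \<theta> where a: "a \<in> unit_disc"
    and \<phi>_eq: "\<phi> = (\<lambda>z. exp (\<i> * complex_of_real \<theta>) * ((z - a) / (1 - cnj a * z)))"
    using \<phi> unfolding Aut_disc_def by blast
  define P where "P = (\<lambda>w. deriv (deriv h) w / deriv h w)"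
  have "deriv h holomorphic_on unit_disc"
    using rep by (auto simp: canonical_rep_def intro: holomorphic_deriv)
  then have holP: "P holomorphic_on unit_disc"
    unfolding P_def using h' by (auto intro!: holomorphic_intros)
  have h'': "deriv (deriv h) z = P z * deriv h z" if "z \<in> unit_disc" for z
    using h'[OF that] by (simp add: P_def)
  have convP: "Re (1 + z * P z) > 0" if "z \<in> unit_disc" for z
    using conv[OF that] by (simp add: P_def)
  have dil': "deriv g z = exp (\<i> * complex_of_real \<theta>) * ((z - a) / (1 - cnj a * z)) * deriv h z"
    if "z \<in> unit_disc" for z
    using dil[OF that] h'[OF that] by (simp add: \<phi>_eq field_simps)
  have a1: "cmod a < 1" using a by simp
  have "(1 - (cmod z)\<^sup>2)\<^sup>2 * cmod (schwarzian f z) \<le> 3" if z: "z \<in> unit_disc" for z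
  proof -
    have "(1 - (cmod z)\<^sup>2)\<^sup>2 * cmod (deriv P z - (cnj z / (1 - z * cnj z))\<^sup>2
        + (cnj a / (1 - cnj a * z))\<^sup>2
        - (P z - cnj z / (1 - z * cnj z) + cnj a / (1 - cnj a * z))\<^sup>2 / 2) \<le> 3"
      using z by (intro schwarzian_pointwise_bound convex_schwarzian_bound holP convP a1) simp_all
    then show ?thesis
      using schwarzian_disc_automorphism_dilatation[OF rep h' holP h'' dil' norm_exp_i_times a1 z]
      by simp
  qed
  then show ?thesis
    unfolding schwarzian_norm_def by (intro SUP_least) (simp only: numeral_eq_ereal ereal_less_eq)
qed

section \<open>Sharpness\<close>

text \<open>Two integrations recover \<open>h\<close> from \<open>h''/h'\<close>, and a third gives \<open>g\<close>, so an extremal mapping can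
  be prescribed through these data without a closed form for \<open>h\<close>.\<close>

lemma exists_harmonic_mapping:
  assumes P: "P holomorphic_on unit_disc" and \<omega>: "\<omega> holomorphic_on unit_disc"
  obtains h g where "canonical_rep (\<lambda>z. h z + cnj (g z)) h g"
    "\<And>z. z \<in> unit_disc \<Longrightarrow> deriv h z \<noteq> 0"
    "\<And>z. z \<in> unit_disc \<Longrightarrow> deriv (deriv h) z = P z * deriv h z"
    "\<And>z. z \<in> unit_disc \<Longrightarrow> deriv g z = \<omega> z * deriv h z"
proof -
  have prim: "\<exists>G. G holomorphic_on unit_disc \<and> G 0 = 0 \<and>
      (\<forall>z\<in>unit_disc. (G has_field_derivative F z) (at z))"
    if F: "F holomorphic_on unit_disc" for F
  proof -
    obtain G where G: "\<And>z. z \<in> unit_disc \<Longrightarrow> (G has_field_derivative F z) (at z within unit_disc)"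
      using holomorphic_convex_primitive'[OF convex_ball open_ball F] by auto
    then have G': "\<And>z. z \<in> unit_disc \<Longrightarrow> (G has_field_derivative F z) (at z)"
      by (metis at_within_open open_ball)
    then have "\<forall>z\<in>unit_disc. ((\<lambda>w. G w - G 0) has_field_derivative F z) (at z)"
      by (auto intro!: derivative_eq_intros)
    moreover from this have "(\<lambda>w. G w - G 0) holomorphic_on unit_disc"
      by (auto simp: holomorphic_on_open)
    ultimately show ?thesis by (intro exI[of _ "\<lambda>w. G w - G 0"]) simp
  qed
  obtain p where p: "p holomorphic_on unit_disc" "p 0 = 0"
      "\<And>z. z \<in> unit_disc \<Longrightarrow> (p has_field_derivative P z) (at z)"
    using prim[OF P] by blast
  have hol_exp: "(\<lambda>z. exp (p z)) holomorphic_on unit_disc"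
    using p(1) by (auto intro!: holomorphic_intros)
  obtain h where h: "h holomorphic_on unit_disc" "h 0 = 0"
      "\<And>z. z \<in> unit_disc \<Longrightarrow> (h has_field_derivative exp (p z)) (at z)"
    using prim[OF hol_exp] by blast
  have "(\<lambda>z. \<omega> z * exp (p z)) holomorphic_on unit_disc"
    using \<omega> hol_exp by (auto intro!: holomorphic_intros)
  then obtain g where g: "g holomorphic_on unit_disc" "g 0 = 0"
      "\<And>z. z \<in> unit_disc \<Longrightarrow> (g has_field_derivative \<omega> z * exp (p z)) (at z)"
    using prim by blast
  have dh: "deriv h z = exp (p z)" if "z \<in> unit_disc" for z
    using h(3)[OF that] by (rule DERIV_imp_deriv)
  show ?thesis
  proof (rule that[of h g])
    show "canonical_rep (\<lambda>z. h z + cnj (g z)) h g"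
      using h(1,2) g(1,2) p(2) dh[of 0] by (simp add: canonical_rep_def)
    fix z assume z: "z \<in> unit_disc"
    show "deriv h z \<noteq> 0" using dh[OF z] by simp
    show "deriv g z = \<omega> z * deriv h z"
      using DERIV_imp_deriv[OF g(3)[OF z]] dh[OF z] by simp
    have "((\<lambda>w. exp (p w)) has_field_derivative P z * exp (p z)) (at z)"
      by (auto intro!: derivative_eq_intros p(3)[OF z])
    then have "(deriv h has_field_derivative P z * exp (p z)) (at z)"
      by (rule has_field_derivative_transform_within_open[where S = unit_disc])
        (use z dh in auto)
    then show "deriv (deriv h) z = P z * deriv h z"
      using dh[OF z] by (simp add: DERIV_imp_deriv)
  qed
qed

text \<open>Here \<open>1 + z P(z) = (1 + z + z\<^sup>2)/(1 - z\<^sup>2)\<close> is a convex combination of \<open>(1 + z)/(1 - z)\<close>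
  and \<open>(1 - z)/(1 + z)\<close>, which makes \<open>h\<close> convex. For \<open>q = 1\<close> the value would be \<open>3\<close>, but then
  \<open>\<omega>\<close> degenerates to a constant and is no automorphism.\<close>

lemma F0_class_schwarzian_near_3:
  fixes q :: real
  assumes q: "0 < q" "q < 1"
  shows "\<exists>f\<in>F0_class. ereal (3/2 + q + q\<^sup>2 / 2) \<le> schwarzian_norm f"
proof -
  define P :: "complex \<Rightarrow> complex" where "P = (\<lambda>z. (1 + 2 * z) / (1 - z\<^sup>2))"
  define a where "a = - complex_of_real q"
  define \<omega> where "\<omega> = (\<lambda>z. (z - a) / (1 - cnj a * z))"
  have a: "cmod a < 1" using q by (simp add: a_def)
  have nz: "1 - z \<noteq> 0" "1 + z \<noteq> 0" "1 - z\<^sup>2 \<noteq> 0" if "z \<in> unit_disc" for z :: complex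
  proof -
    show 1: "1 - z \<noteq> 0" "1 + z \<noteq> 0"
      using that by (auto simp: add_eq_0_iff)
    have "1 - z\<^sup>2 = (1 - z) * (1 + z)" by (simp add: power2_eq_square algebra_simps)
    then show "1 - z\<^sup>2 \<noteq> 0" using 1 by simp
  qed
  have holP: "P holomorphic_on unit_disc"
    unfolding P_def using nz(3) by (auto intro!: holomorphic_intros)
  have hol\<omega>: "\<omega> holomorphic_on unit_disc"
    unfolding \<omega>_def using one_minus_cnj_mult_nonzero[OF a] by (auto intro!: holomorphic_intros)
  have cayley: "Re ((1 + w) / (1 - w)) > 0" if "w \<in> unit_disc" for w
  proof -
    have "(cmod w)\<^sup>2 < 1" using that by (simp add: power_less_one_iff abs_square_less_1)
    then show ?thesis
      unfolding Re_complex_div_gt_0 cmod_power2 by (simp add: power2_eq_square algebra_simps)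
  qed
  have convP: "Re (1 + z * P z) > 0" if z: "z \<in> unit_disc" for z
  proof -
    have e: "1 - z\<^sup>2 = (1 - z) * (1 + z)" by (simp add: power2_eq_square algebra_simps)
    have "1 + z * P z = (3 * ((1 + z) / (1 - z)) + (1 - z) / (1 + z)) / 4"
      using nz[OF z] unfolding P_def e by (simp add: divide_simps) (simp add: algebra_simps)
    then have "Re (1 + z * P z)
        = Re ((3 * ((1 + z) / (1 - z)) + (1 - z) / (1 + z)) / 4)" by (rule arg_cong)
    also have "\<dots> = (3 * Re ((1 + z) / (1 - z)) + Re ((1 - z) / (1 + z))) / 4"
      unfolding Re_divide_numeral plus_complex.simps(1) times_complex.simps(1)
        complex_Re_numeral complex_Im_numeral by (simp only: mult_zero_left diff_zero)
    finally have "Re (1 + z * P z) = (3 * Re ((1 + z) / (1 - z)) + Re ((1 - z) / (1 + z))) / 4" .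
    then show ?thesis using cayley[of z] cayley[of "- z"] z by simp
  qed
  obtain h g where rep: "canonical_rep (\<lambda>z. h z + cnj (g z)) h g"
    and h': "\<And>z. z \<in> unit_disc \<Longrightarrow> deriv h z \<noteq> 0"
    and h'': "\<And>z. z \<in> unit_disc \<Longrightarrow> deriv (deriv h) z = P z * deriv h z"
    and g': "\<And>z. z \<in> unit_disc \<Longrightarrow> deriv g z = \<omega> z * deriv h z"
    using exists_harmonic_mapping[OF holP hol\<omega>] by blast
  define f where "f = (\<lambda>z. h z + cnj (g z))"
  have "\<omega> \<in> Aut_disc"
    unfolding Aut_disc_def \<omega>_def using a by (intro CollectI exI[of _ a] exI[of _ 0]) simp
  moreover have "\<forall>z\<in>unit_disc. deriv g z / deriv h z = \<omega> z"
    using g' h' by simp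
  moreover have "\<forall>z\<in>unit_disc. Re (1 + z * deriv (deriv h) z / deriv h z) > 0"
    using convP h' h'' by (simp del: plus_complex.simps times_complex.simps)
  moreover have "canonical_rep f h g"
    using rep by (simp add: f_def)
  ultimately have "f \<in> F0_class"
    using h' unfolding F0_class_def harmonic_class_def by blast
  have P0: "P 0 = 1" by (simp add: P_def)
  have dP: "deriv P 0 = 2"
  proof -
    have "(P has_field_derivative 2) (at 0)"
      unfolding P_def by (rule derivative_eq_intros refl | simp)+
    then show ?thesis by (rule DERIV_imp_deriv)
  qed
  have "schwarzian f 0 = complex_of_real (3/2 + q + q\<^sup>2 / 2)"
    using schwarzian_disc_automorphism_dilatation[OF rep h' holP h'' _ norm_one a, of 0] g'
    unfolding f_def[symmetric] \<omega>_def
    by (simp add: dP P0 a_def power2_eq_square field_simps)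
  then have "cmod (schwarzian f 0) = 3/2 + q + q\<^sup>2 / 2"
    using q by (simp only: norm_of_real) simp
  then have "ereal (3/2 + q + q\<^sup>2 / 2) \<le> schwarzian_norm f"
    unfolding schwarzian_norm_def by (intro SUP_upper2[of 0]) simp_all
  then show ?thesis using \<open>f \<in> F0_class\<close> by blast
qed

theorem theorem4p2:
  shows "(\<forall>f\<in>F0_class. schwarzian_norm f \<le> 3) \<and>
         \<not> (\<exists>c::real. c < 3 \<and> (\<forall>f\<in>F0_class. schwarzian_norm f \<le> ereal c))"
proof (intro conjI ballI notI)
  fix f assume "f \<in> F0_class"
  then show "schwarzian_norm f \<le> 3" by (rule schwarzian_norm_F0_class_le)
next
  assume "\<exists>c::real. c < 3 \<and> (\<forall>f\<in>F0_class. schwarzian_norm f \<le> ereal c)"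
  then obtain c :: real where c: "c < 3" "\<And>f. f \<in> F0_class \<Longrightarrow> schwarzian_norm f \<le> ereal c"
    by blast
  have bound: "3/2 + q + q\<^sup>2 / 2 \<le> c" if "0 < q" "q < 1" for q :: real
    using F0_class_schwarzian_near_3[OF that] c(2) by (metis ereal_less_eq(3) order_trans)
  have "((\<lambda>q::real. 3/2 + q + q\<^sup>2 / 2) \<longlongrightarrow> 3/2 + 1 + 1\<^sup>2 / 2) (at_left 1)"
    by (intro tendsto_intros) auto
  then have "3/2 + 1 + 1\<^sup>2 / 2 \<le> c"
    by (rule tendsto_upperbound)
      (auto intro!: eventually_at_leftI[of 0] bound)
  then show False using c(1) by simp
qed

end
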